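(* Let $\Gamma=(V,E)$ and $\Gamma'=(V',E')$ be finite connected simple graphs, both regular of the same degree $d\ge1$, with $m=|V|$ and $n=|V'|$. Let $0=\lambda'_0<\lambda'_1\leq\cdots\leq\lambda'_{n-1}$ be the eigenvalues of the normalized Laplacian $\mathcal{L}'$ of $\Gamma'$. Let $C$ be the circle $\{\alpha\in\mathbb{C}:|\alpha-(2+\lambda'_1/2)|=2\}$, traversed clockwise. Let $\mathcal{G}_\alpha,\mathcal{G}$ (resp. $\mathcal{G}'_\alpha,\mathcal{G}'$) be the generalized Green's function and normalized Green's function of $\Gamma$ (resp. $\Gamma'$), and let $\mathbf{G}$ be the normalized Green's function of $\Gamma\times\Gamma'$. Then for all $x,y\in V$, $x',y'\in V'$, $$\mathbf{G}((x,x'),(y,y'))=\frac{1}{\pi i}\int_C\mathcal{G}_\alpha(x,y)\,\mathcal{G}'_{-\alpha}(x',y')\,d\alpha+\frac{2}{n}\mathcal{G}(x,y)+\frac{2}{m}\mathcal{G}'(x',y').$$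
   Context: For a connected $\delta$-regular graph $\Gamma=(V,E)$, the normalized Laplacian $\mathcal{L}$ is the $V\times V$ matrix with $\mathcal{L}(x,x)=1$, $\mathcal{L}(x,y)=-1/\delta$ if $x\sim y$, $0$ otherwise. Let $\{(\lambda_j,\phi_j)\}$ be an orthonormal eigensystem of $\mathcal{L}$ (possibly complex eigenvectors, orthonormal for $\langle f,g\rangle=\sum f\overline g$); the eigenvalue $0$ is simple with eigenvector constant $1/\sqrt{|V|}$. For $\alpha\in\mathbb{C}$ with $-\alpha$ not a positive eigenvalue, the generalized Green's function is $\mathcal{G}_\alpha(x,y)=\sum_{j:\lambda_j>0}\frac{1}{\lambda_j+\alpha}\phi_j(x)\overline{\phi_j(y)}$ (equivalently the symmetric matrix with $(\mathcal{L}+\alpha)\mathcal{G}_\alpha=I-P_0$, $\mathcal{G}_\alpha P_0=0$, $P_0$ the projection onto the constants), and the normalized Green's function is $\mathcal{G}=\mathcal{G}_0$. The Cartesian product $\Gamma\times\Gamma'$ has vertex set $V\times V'$ with $(v,v')\sim(u,u')$ iff ($v=u$, $v'\sim u'$) or ($v'=u'$, $v\sim u$); its normalized Green's function $\mathbf{G}$ is defined in the same way from its normalized Laplacian. *)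

theory Defs
  imports "HOL-Complex_Analysis.Complex_Analysis" "Graph_Theory.Graph_Theory"
begin

text \<open>
  Finite simple graphs are the \<open>pair_graph\<close>s of \<open>Graph_Theory\<close>: finite, loop-free digraphs
  without parallel arcs whose arc relation \<open>parcs\<close> is symmetric, so that adjacency of \<open>x\<close> and
  \<open>y\<close> is \<open>(x, y) \<in> parcs G\<close> and the out-degree is the usual degree.
\<close>

definition regular_graph :: "'a pair_pre_digraph \<Rightarrow> nat \<Rightarrow> bool" where
  "regular_graph G d \<longleftrightarrow> (\<forall>v\<in>pverts G. out_degree (with_proj G) v = d)"

definition cartesian_product ::
  "'a pair_pre_digraph \<Rightarrow> 'b pair_pre_digraph \<Rightarrow> ('a \<times> 'b) pair_pre_digraph" where
  "cartesian_product G H =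
     \<lparr> pverts = pverts G \<times> pverts H,
       parcs = {((v, v'), (u, u')) | v v' u u'.
                  (v \<in> pverts G \<and> v = u \<and> (v', u') \<in> parcs H) \<or>
                  (v' \<in> pverts H \<and> v' = u' \<and> (v, u) \<in> parcs G)} \<rparr>"

text \<open>
  Only used for regular graphs, where the degree of the row vertex is the common degree.
\<close>

definition normalized_laplacian :: "'a pair_pre_digraph \<Rightarrow> 'a \<Rightarrow> 'a \<Rightarrow> real" where
  "normalized_laplacian G x y =
     (if x = y then 1
      else if (x, y) \<in> parcs G then - 1 / real (out_degree (with_proj G) x)
      else 0)"

text \<open>
  The eigensystem is indexed by \<open>j < |V|\<close>, eigenvalues being repeated according to multiplicity;
  \<open>|V|\<close> orthonormal vectors in the \<open>|V|\<close>-dimensional space of functions on \<open>V\<close> form a basis.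
  The eigenvalues are real because the matrix is symmetric.
\<close>

definition orthonormal_eigensystem ::
  "'a pair_pre_digraph \<Rightarrow> (nat \<Rightarrow> real) \<Rightarrow> (nat \<Rightarrow> 'a \<Rightarrow> complex) \<Rightarrow> bool" where
  "orthonormal_eigensystem G ev \<phi> \<longleftrightarrow>
     (\<forall>j < card (pverts G). \<forall>x \<in> pverts G.
        (\<Sum>y\<in>pverts G. of_real (normalized_laplacian G x y) * \<phi> j y) = of_real (ev j) * \<phi> j x) \<and>
     (\<forall>j < card (pverts G). \<forall>k < card (pverts G).
        (\<Sum>x\<in>pverts G. \<phi> j x * cnj (\<phi> k x)) = (if j = k then 1 else 0))"

text \<open>
  The value does not depend on which orthonormal eigensystem \<open>(ev, \<phi>)\<close> of \<open>G\<close> is used.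
  It is meaningful when \<open>-\<alpha>\<close> is not a positive eigenvalue.
\<close>

definition generalized_green ::
  "'a pair_pre_digraph \<Rightarrow> (nat \<Rightarrow> real) \<Rightarrow> (nat \<Rightarrow> 'a \<Rightarrow> complex) \<Rightarrow> complex \<Rightarrow> 'a \<Rightarrow> 'a \<Rightarrow> complex"
  where
  "generalized_green G ev \<phi> \<alpha> x y =
     (\<Sum>j | j < card (pverts G) \<and> ev j > 0. 1 / (of_real (ev j) + \<alpha>) * \<phi> j x * cnj (\<phi> j y))"

definition normalized_green ::
  "'a pair_pre_digraph \<Rightarrow> (nat \<Rightarrow> real) \<Rightarrow> (nat \<Rightarrow> 'a \<Rightarrow> complex) \<Rightarrow> 'a \<Rightarrow> 'a \<Rightarrow> complex" where
  "normalized_green G ev \<phi> = generalized_green G ev \<phi> 0"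

end

theory Submission
  imports Defs
begin

text \<open>
  Since the product graph is regular of degree \<open>2 d\<close>, its Laplacian is
  \<open>(L \<otimes> 1 + 1 \<otimes> L') / 2\<close>, so the functions \<open>\<phi>\<^sub>j \<otimes> \<phi>'\<^sub>k\<close> form an orthonormal eigenbasis with
  eigenvalues \<open>(\<lambda>\<^sub>j + \<lambda>'\<^sub>k) / 2\<close>; spectral sums do not depend on the eigenbasis, so the Green's
  function of the product is the sum of \<open>2 / (\<lambda>\<^sub>j + \<lambda>'\<^sub>k)\<close> times the corresponding projections over
  \<open>(j, k) \<noteq> (0, 0)\<close>. By connectedness the eigenvalue \<open>0\<close> of each factor is simple with a constant
  eigenvector, so the terms with \<open>k = 0\<close> or \<open>j = 0\<close> give the two single Green's functions. For the
  terms with \<open>j, k > 0\<close>, the circle encloses all \<open>\<lambda>'\<^sub>k\<close> (they lie between \<open>\<lambda>'\<^sub>1\<close> and \<open>2\<close>) and no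
  \<open>-\<lambda>\<^sub>j\<close>, and Cauchy's integral formula evaluates the contour integral at the poles \<open>\<lambda>'\<^sub>k\<close>.
\<close>

section \<open>Orthonormal eigenbases of real symmetric matrices\<close>

text \<open>The index type is arbitrary so that systems numbered by naturals and by pairs are
  covered alike. Spanning is encoded by the count \<open>card_I\<close>, from which completeness is
  derived.\<close>

locale orthonormal_eigenbasis =
  fixes V :: "'v set" and A :: "'v \<Rightarrow> 'v \<Rightarrow> real"
    and I :: "'i set" and \<mu> :: "'i \<Rightarrow> real" and \<psi> :: "'i \<Rightarrow> 'v \<Rightarrow> complex"
  assumes finite_V: "finite V" and finite_I: "finite I" and card_I: "card I = card V"
    and sym: "\<And>x y. x \<in> V \<Longrightarrow> y \<in> V \<Longrightarrow> A x y = A y x"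
    and eigen: "\<And>i x. i \<in> I \<Longrightarrow> x \<in> V \<Longrightarrow> (\<Sum>y\<in>V. of_real (A x y) * \<psi> i y) = of_real (\<mu> i) * \<psi> i x"
    and ortho: "\<And>i j. i \<in> I \<Longrightarrow> j \<in> I \<Longrightarrow> (\<Sum>x\<in>V. \<psi> i x * cnj (\<psi> j x)) = (if i = j then 1 else 0)"
begin

text \<open>
  The squared distance of the indicator of \<open>z\<close> to its orthogonal projection is \<open>1 - S z z\<close>; summed
  over \<open>z\<close> this is \<open>card V - card I = 0\<close>, so each distance vanishes.
\<close>

lemma complete:
  assumes x: "x \<in> V" and y: "y \<in> V"
  shows "(\<Sum>i\<in>I. \<psi> i x * cnj (\<psi> i y)) = (if x = y then 1 else 0)"
proof -
  define S where "S z w = (\<Sum>i\<in>I. \<psi> i w * cnj (\<psi> i z))" for z w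
  define \<Delta> where "\<Delta> z w = (if w = z then 1 else 0 :: complex)" for z w :: 'v
  have cnj_S: "cnj (S z z) = S z z" for z
    by (simp add: S_def mult.commute)
  \<comment> \<open>\<open>S z\<close> is the projected indicator of \<open>z\<close>.
    Orthonormality collapses the double sum: this is idempotence of the projection, read on the
    diagonal.\<close>
  have SS: "(\<Sum>w\<in>V. S z w * cnj (S z w)) = S z z" for z
  proof -
    have "(\<Sum>w\<in>V. S z w * cnj (S z w))
        = (\<Sum>w\<in>V. \<Sum>i\<in>I. \<Sum>j\<in>I. cnj (\<psi> i z) * \<psi> j z * (\<psi> i w * cnj (\<psi> j w)))"
      by (simp add: S_def sum_product mult_ac)
    also have "\<dots> = (\<Sum>i\<in>I. \<Sum>w\<in>V. \<Sum>j\<in>I. cnj (\<psi> i z) * \<psi> j z * (\<psi> i w * cnj (\<psi> j w)))"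
      by (rule sum.swap)
    also have "\<dots> = (\<Sum>i\<in>I. \<Sum>j\<in>I. \<Sum>w\<in>V. cnj (\<psi> i z) * \<psi> j z * (\<psi> i w * cnj (\<psi> j w)))"
      by (intro sum.cong refl sum.swap)
    also have "\<dots> = (\<Sum>i\<in>I. \<Sum>j\<in>I. cnj (\<psi> i z) * \<psi> j z * (if i = j then 1 else 0))"
      by (intro sum.cong refl) (simp only: sum_distrib_left[symmetric] ortho)
    also have "\<dots> = S z z"
      by (simp add: S_def finite_I mult.commute if_distrib cong: if_cong)
    finally show ?thesis .
  qed
  have dist: "(\<Sum>w\<in>V. (cmod (\<Delta> z w - S z w))\<^sup>2) = 1 - Re (S z z)" if z: "z \<in> V" for z
  proof -
    have "of_real (\<Sum>w\<in>V. (cmod (\<Delta> z w - S z w))\<^sup>2)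
        = (\<Sum>w\<in>V. (\<Delta> z w - S z w) * cnj (\<Delta> z w - S z w))"
      by (simp only: of_real_sum complex_norm_square)
    also have "\<dots> = (\<Sum>w\<in>V. (if w = z then 1 - S z w - cnj (S z w) else 0) + S z w * cnj (S z w))"
      by (intro sum.cong refl) (simp add: \<Delta>_def algebra_simps)
    also have "\<dots> = 1 - S z z - cnj (S z z) + S z z"
      using z by (simp add: sum.distrib SS finite_V)
    also have "\<dots> = 1 - S z z"
      by (simp add: cnj_S)
    finally have "Re (of_real (\<Sum>w\<in>V. (cmod (\<Delta> z w - S z w))\<^sup>2)) = Re (1 - S z z)"
      by (rule arg_cong)
    then show ?thesis by simp
  qed
  have "(\<Sum>z\<in>V. S z z) = (\<Sum>i\<in>I. \<Sum>z\<in>V. \<psi> i z * cnj (\<psi> i z))"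
    unfolding S_def by (rule sum.swap)
  also have "\<dots> = of_nat (card V)"
    by (simp add: ortho card_I)
  finally have "Re (\<Sum>z\<in>V. S z z) = Re (of_nat (card V))"
    by (rule arg_cong)
  then have "(\<Sum>z\<in>V. \<Sum>w\<in>V. (cmod (\<Delta> z w - S z w))\<^sup>2) = 0"
    by (simp add: dist sum_subtractf)
  then have "\<forall>z\<in>V. \<forall>w\<in>V. (cmod (\<Delta> z w - S z w))\<^sup>2 = 0"
    by (simp add: finite_V sum_nonneg_eq_0_iff sum_nonneg)
  then have "\<Delta> y x = S y x"
    using x y by simp
  then show ?thesis
    by (simp add: S_def \<Delta>_def)
qed

text \<open>Symmetry and reality of \<open>A\<close> let it move from one factor of the inner
  product to the other. The eigenfunction \<open>f\<close> is arbitrary, so this serves both to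
  compare two eigenbases and to treat constants.\<close>

lemma eigenfunction_orthogonal:
  fixes f :: "'v \<Rightarrow> complex" and \<nu> :: real
  assumes f: "\<And>x. x \<in> V \<Longrightarrow> (\<Sum>y\<in>V. of_real (A x y) * f y) = of_real \<nu> * f x"
    and i: "i \<in> I" and ne: "\<mu> i \<noteq> \<nu>"
  shows "(\<Sum>x\<in>V. \<psi> i x * cnj (f x)) = 0"
proof -
  have cnj_f: "(\<Sum>y\<in>V. of_real (A x y) * cnj (f y)) = of_real \<nu> * cnj (f x)" if "x \<in> V" for x
    using arg_cong[OF f[OF that], of cnj] by simp
  have "of_real (\<mu> i) * (\<Sum>x\<in>V. \<psi> i x * cnj (f x))
      = (\<Sum>x\<in>V. (\<Sum>y\<in>V. of_real (A x y) * \<psi> i y) * cnj (f x))"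
    unfolding sum_distrib_left by (intro sum.cong refl) (simp only: eigen[OF i] mult.assoc)
  also have "\<dots> = (\<Sum>x\<in>V. \<Sum>y\<in>V. of_real (A x y) * \<psi> i y * cnj (f x))"
    by (simp add: sum_distrib_right)
  also have "\<dots> = (\<Sum>y\<in>V. \<Sum>x\<in>V. of_real (A x y) * \<psi> i y * cnj (f x))"
    by (rule sum.swap)
  also have "\<dots> = (\<Sum>y\<in>V. \<psi> i y * (\<Sum>x\<in>V. of_real (A y x) * cnj (f x)))"
    unfolding sum_distrib_left by (intro sum.cong refl) (simp add: sym mult_ac)
  also have "\<dots> = of_real \<nu> * (\<Sum>x\<in>V. \<psi> i x * cnj (f x))"
    unfolding sum_distrib_left[of "of_real \<nu>"]
    by (intro sum.cong refl) (simp add: cnj_f)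
  finally have "(of_real (\<mu> i) - of_real \<nu>) * (\<Sum>x\<in>V. \<psi> i x * cnj (f x)) = 0"
    by (simp add: algebra_simps)
  with ne show ?thesis
    by simp
qed

end

text \<open>The overlap \<open>c i j\<close> of two basis vectors vanishes unless their eigenvalues
  agree, so in the double expansion \<open>h (\<mu> i)\<close> may be traded for
  \<open>h (\<nu> j)\<close>. This makes the given eigensystem of the product interchangeable with
  the tensor basis.\<close>

lemma spectral_sum_unique:
  assumes "orthonormal_eigenbasis V A I \<mu> \<psi>" and "orthonormal_eigenbasis V A J \<nu> \<theta>"
    and x: "x \<in> V" and y: "y \<in> V"
  shows "(\<Sum>i\<in>I. h (\<mu> i) * \<psi> i x * cnj (\<psi> i y)) = (\<Sum>j\<in>J. h (\<nu> j) * \<theta> j x * cnj (\<theta> j y))"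
proof -
  interpret P: orthonormal_eigenbasis V A I \<mu> \<psi> by fact
  interpret Q: orthonormal_eigenbasis V A J \<nu> \<theta> by fact
  define c where "c i j = (\<Sum>z\<in>V. \<psi> i z * cnj (\<theta> j z))" for i j
  have hc: "h (\<mu> i) * c i j = h (\<nu> j) * c i j" if "i \<in> I" "j \<in> J" for i j
    using P.eigenfunction_orthogonal[of "\<theta> j" "\<nu> j" i] Q.eigen that
    by (cases "\<mu> i = \<nu> j") (auto simp: c_def)
  have expand_P: "\<psi> i x = (\<Sum>j\<in>J. c i j * \<theta> j x)" for i
  proof -
    have "(\<Sum>j\<in>J. c i j * \<theta> j x) = (\<Sum>j\<in>J. \<Sum>z\<in>V. \<psi> i z * (\<theta> j x * cnj (\<theta> j z)))"
      unfolding c_def sum_distrib_right by (intro sum.cong refl) (simp add: mult_ac)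
    also have "\<dots> = (\<Sum>z\<in>V. \<Sum>j\<in>J. \<psi> i z * (\<theta> j x * cnj (\<theta> j z)))"
      by (rule sum.swap)
    also have "\<dots> = (\<Sum>z\<in>V. \<psi> i z * (if x = z then 1 else 0))"
      by (intro sum.cong refl) (simp only: sum_distrib_left[symmetric] Q.complete[OF x])
    also have "\<dots> = \<psi> i x"
      using x by (simp add: P.finite_V if_distrib cong: if_cong)
    finally show ?thesis by simp
  qed
  \<comment> \<open>Expanding the conjugate makes the same coefficients \<open>c i j\<close> appear,
    so that the final sum over \<open>i\<close> recombines.\<close>
  have expand_Q: "cnj (\<theta> j y) = (\<Sum>i\<in>I. c i j * cnj (\<psi> i y))" for j
  proof -
    have "(\<Sum>i\<in>I. c i j * cnj (\<psi> i y)) = (\<Sum>i\<in>I. \<Sum>z\<in>V. cnj (\<theta> j z) * (\<psi> i z * cnj (\<psi> i y)))"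
      unfolding c_def sum_distrib_right by (intro sum.cong refl) (simp add: mult_ac)
    also have "\<dots> = (\<Sum>z\<in>V. \<Sum>i\<in>I. cnj (\<theta> j z) * (\<psi> i z * cnj (\<psi> i y)))"
      by (rule sum.swap)
    also have "\<dots> = (\<Sum>z\<in>V. cnj (\<theta> j z) * (if z = y then 1 else 0))"
      by (intro sum.cong refl) (simp only: sum_distrib_left[symmetric] P.complete[OF _ y])
    also have "\<dots> = cnj (\<theta> j y)"
      using y by (simp add: P.finite_V if_distrib cong: if_cong)
    finally show ?thesis by simp
  qed
  have "(\<Sum>i\<in>I. h (\<mu> i) * \<psi> i x * cnj (\<psi> i y))
      = (\<Sum>i\<in>I. \<Sum>j\<in>J. h (\<mu> i) * c i j * (\<theta> j x * cnj (\<psi> i y)))"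
    unfolding expand_P by (simp add: sum_distrib_left sum_distrib_right mult_ac)
  also have "\<dots> = (\<Sum>i\<in>I. \<Sum>j\<in>J. h (\<nu> j) * c i j * (\<theta> j x * cnj (\<psi> i y)))"
    by (intro sum.cong refl) (simp only: hc)
  also have "\<dots> = (\<Sum>j\<in>J. \<Sum>i\<in>I. h (\<nu> j) * c i j * (\<theta> j x * cnj (\<psi> i y)))"
    by (rule sum.swap)
  also have "\<dots> = (\<Sum>j\<in>J. h (\<nu> j) * \<theta> j x * cnj (\<theta> j y))"
    unfolding expand_Q by (simp add: sum_distrib_left mult_ac)
  finally show ?thesis .
qed

text \<open>\<open>C\<close> is half the Kronecker sum of \<open>A\<close> and \<open>B\<close>: on
  a tensor of eigenvectors its two terms act on separate factors, so the eigenvalues add. Inner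
  products factor, and the index pairs are as many as the points.\<close>

lemma orthonormal_eigenbasis_product:
  assumes "orthonormal_eigenbasis V A I \<mu> \<psi>" and "orthonormal_eigenbasis W B J \<nu> \<theta>"
    and C: "\<And>x x' y y'. x \<in> V \<Longrightarrow> y \<in> V \<Longrightarrow> x' \<in> W \<Longrightarrow> y' \<in> W \<Longrightarrow>
      C (x, x') (y, y') = (A x y * (if x' = y' then 1 else 0) + (if x = y then 1 else 0) * B x' y') / 2"
  shows "orthonormal_eigenbasis (V \<times> W) C (I \<times> J) (\<lambda>(i, j). (\<mu> i + \<nu> j) / 2)
    (\<lambda>(i, j) (x, y). \<psi> i x * \<theta> j y)"
proof -
  interpret P: orthonormal_eigenbasis V A I \<mu> \<psi> by fact
  interpret Q: orthonormal_eigenbasis W B J \<nu> \<theta> by fact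
  show ?thesis
  proof
    show "finite (V \<times> W)" "finite (I \<times> J)" "card (I \<times> J) = card (V \<times> W)"
      by (simp_all add: P.finite_V P.finite_I Q.finite_V Q.finite_I P.card_I Q.card_I card_cartesian_product)
    show "C p q = C q p" if "p \<in> V \<times> W" "q \<in> V \<times> W" for p q
      using that by (auto simp: C P.sym Q.sym)
  next
    fix k p assume "k \<in> I \<times> J" "p \<in> V \<times> W"
    then obtain i j x x' where k: "k = (i, j)" "i \<in> I" "j \<in> J" and p: "p = (x, x')" "x \<in> V" "x' \<in> W"
      by auto
    have "(\<Sum>q\<in>V \<times> W. of_real (C p q) * (case k of (i, j) \<Rightarrow> \<lambda>(x, y). \<psi> i x * \<theta> j y) q)
       = (\<Sum>y\<in>V. \<Sum>y'\<in>W. of_real (C (x, x') (y, y')) * (\<psi> i y * \<theta> j y'))"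
      by (simp add: k p sum.cartesian_product case_prod_beta)
    also have "\<dots> = (\<Sum>y\<in>V. \<Sum>y'\<in>W. (if x' = y' then of_real (A x y) * \<psi> i y * \<theta> j y' / 2 else 0)
         + (if x = y then of_real (B x' y') * \<theta> j y' * \<psi> i y / 2 else 0))"
      by (intro sum.cong refl) (simp add: C p field_simps)
    also have "\<dots> = (\<Sum>y\<in>V. of_real (A x y) * \<psi> i y * \<theta> j x' / 2
         + (if x = y then (\<Sum>y'\<in>W. of_real (B x' y') * \<theta> j y') * \<psi> i y / 2 else 0))"
      using p by (intro sum.cong refl)
        (simp add: sum.distrib Q.finite_V sum_distrib_right sum_divide_distrib)
    also have "\<dots> = (\<Sum>y\<in>V. of_real (A x y) * \<psi> i y) * \<theta> j x' / 2
         + (\<Sum>y'\<in>W. of_real (B x' y') * \<theta> j y') * \<psi> i x / 2"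
      using p by (simp add: sum.distrib P.finite_V sum_distrib_right sum_divide_distrib)
    also have "\<dots> = of_real ((\<mu> i + \<nu> j) / 2) * (\<psi> i x * \<theta> j x')"
      using k p by (simp only: P.eigen Q.eigen) (simp add: field_simps)
    finally show "(\<Sum>q\<in>V \<times> W. of_real (C p q) * (case k of (i, j) \<Rightarrow> \<lambda>(x, y). \<psi> i x * \<theta> j y) q)
        = of_real (case k of (i, j) \<Rightarrow> (\<mu> i + \<nu> j) / 2) * (case k of (i, j) \<Rightarrow> \<lambda>(x, y). \<psi> i x * \<theta> j y) p"
      by (simp add: k p)
  next
    fix k l assume "k \<in> I \<times> J" "l \<in> I \<times> J"
    then obtain i j i' j' where k: "k = (i, j)" "i \<in> I" "j \<in> J" and l: "l = (i', j')" "i' \<in> I" "j' \<in> J"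
      by auto
    have "(\<Sum>p\<in>V \<times> W. (case k of (i, j) \<Rightarrow> \<lambda>(x, y). \<psi> i x * \<theta> j y) p
           * cnj ((case l of (i, j) \<Rightarrow> \<lambda>(x, y). \<psi> i x * \<theta> j y) p))
       = (\<Sum>x\<in>V. \<psi> i x * cnj (\<psi> i' x)) * (\<Sum>y\<in>W. \<theta> j y * cnj (\<theta> j' y))"
      by (simp add: k l sum_product sum.cartesian_product case_prod_beta mult_ac)
    also have "\<dots> = (if k = l then 1 else 0)"
      using k l by (simp add: P.ortho Q.ortho)
    finally show "(\<Sum>p\<in>V \<times> W. (case k of (i, j) \<Rightarrow> \<lambda>(x, y). \<psi> i x * \<theta> j y) p
           * cnj ((case l of (i, j) \<Rightarrow> \<lambda>(x, y). \<psi> i x * \<theta> j y) p)) = (if k = l then 1 else 0)" .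
  qed
qed

section \<open>The normalized Laplacian of a regular graph\<close>

definition adjacency :: "'a pair_pre_digraph \<Rightarrow> 'a \<Rightarrow> 'a \<Rightarrow> real" where
  "adjacency G x y = of_bool ((x, y) \<in> parcs G)"

lemma adjacency_nonneg: "adjacency G x y \<ge> 0"
  by (simp add: adjacency_def)

text \<open>Stated for any finite vertex set containing all arc heads, so that it also serves the
  Cartesian product, for which no \<open>pair_graph\<close> instance is established.\<close>

lemma sum_adjacency:
  assumes "finite (pverts G)" and "\<And>u v. (u, v) \<in> parcs G \<Longrightarrow> v \<in> pverts G"
  shows "(\<Sum>y\<in>pverts G. adjacency G x y) = real (out_degree (with_proj G) x)"
proof -
  have "out_arcs (with_proj G) x = Pair x ` {y \<in> pverts G. (x, y) \<in> parcs G}"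
    using assms(2) by (auto simp: out_arcs_def)
  then have "out_degree (with_proj G) x = card {y \<in> pverts G. (x, y) \<in> parcs G}"
    by (simp add: out_degree_def card_image inj_on_def)
  moreover have "(\<Sum>y\<in>pverts G. adjacency G x y) = real (card {y \<in> pverts G. (x, y) \<in> parcs G})"
    using assms(1) by (simp add: adjacency_def of_bool_def sum.If_cases Int_def)
  ultimately show ?thesis by simp
qed

locale connected_regular_graph = pair_graph G for G :: "'a pair_pre_digraph" +
  fixes d :: nat
  assumes conn: "Digraph_Component.connected (with_proj G)"
    and regular: "regular_graph G d" and degree_pos: "d \<ge> 1"
begin

lemma arc_in_verts: "(u, v) \<in> parcs G \<Longrightarrow> u \<in> pverts G \<and> v \<in> pverts G"
  using arc_fst_in_verts[of "(u, v)"] arc_snd_in_verts[of "(u, v)"] by simp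

lemma no_loop: "(v, v) \<notin> parcs G"
  using pair_no_loops[of "(v, v)"] by auto

lemma verts_nonempty: "pverts G \<noteq> {}"
  using conn by (auto simp: connected_conv)

lemma adjacency_sym: "adjacency G x y = adjacency G y x"
  using pair_sym_arcs by (auto simp: adjacency_def symmetric_def dest: symD)

lemma adjacency_row: "x \<in> pverts G \<Longrightarrow> (\<Sum>y\<in>pverts G. adjacency G x y) = real d"
  using regular by (subst sum_adjacency) (auto simp: pair_finite_verts regular_graph_def dest: arc_in_verts)

lemma laplacian_eq:
  "x \<in> pverts G \<Longrightarrow> normalized_laplacian G x y = (if x = y then 1 else 0) - adjacency G x y / real d"
  using regular no_loop by (auto simp: normalized_laplacian_def adjacency_def regular_graph_def)

text \<open>Without loops a single vertex would have degree 0. The bound makes 1 a legitimate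
  eigenvalue index.\<close>

lemma card_verts_ge_2: "card (pverts G) \<ge> 2"
proof (rule ccontr)
  assume "\<not> card (pverts G) \<ge> 2"
  moreover have "card (pverts G) \<noteq> 0"
    using verts_nonempty pair_finite_verts by simp
  ultimately have "card (pverts G) = 1" by linarith
  then obtain v where v: "pverts G = {v}"
    by (auto simp: card_1_singleton_iff)
  then have "real d = 0"
    using adjacency_row[of v] no_loop[of v] by (simp add: adjacency_def)
  with degree_pos show False by simp
qed

text \<open>Symmetric arcs turn connectedness into directed reachability, along which equality
  propagates.\<close>

lemma constant_if_constant_on_arcs:
  assumes f: "\<And>u v. (u, v) \<in> parcs G \<Longrightarrow> f u = f v"
    and x: "x \<in> pverts G" and y: "y \<in> pverts G"
  shows "f x = f y"
proof -
  have "strongly_connected (with_proj G)"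
    using conn pair_sym_arcs by (rule symmetric_connected_imp_strongly_connected[rotated])
  then have "x \<rightarrow>\<^sup>*\<^bsub>with_proj G\<^esub> y"
    using x y by (auto simp: strongly_connected_def)
  then show ?thesis
    by (induction rule: reachable_induct) (auto dest: f)
qed

text \<open>When \<open>|f x - f y|^2\<close> is expanded, each diagonal part contributes
  \<open>d\<close> times the squared norm by regularity, and the two cross parts coincide by
  symmetry. Nonnegativity, the upper bound 2 and the kernel are all read off from this form.\<close>

lemma dirichlet_form:
  fixes f :: "'a \<Rightarrow> complex"
  shows "(\<Sum>x\<in>pverts G. cnj (f x) * (\<Sum>y\<in>pverts G. of_real (normalized_laplacian G x y) * f y))
    = of_real ((\<Sum>x\<in>pverts G. \<Sum>y\<in>pverts G. adjacency G x y * (cmod (f x - f y))\<^sup>2) / (2 * real d))"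
proof -
  let ?V = "pverts G" and ?a = "\<lambda>x y. of_real (adjacency G x y) :: complex"
  have fin: "finite ?V" by (rule pair_finite_verts)
  define N where "N = (\<Sum>x\<in>?V. f x * cnj (f x))"
  define X where "X = (\<Sum>x\<in>?V. \<Sum>y\<in>?V. ?a x y * (cnj (f x) * f y))"
  have row: "(\<Sum>y\<in>?V. ?a x y) = of_nat d" if "x \<in> ?V" for x
    using adjacency_row[OF that] by (metis of_real_of_nat_eq of_real_sum)
  have 1: "(\<Sum>x\<in>?V. \<Sum>y\<in>?V. ?a x y * (f x * cnj (f x))) = of_nat d * N"
    by (simp add: sum_distrib_right[symmetric] row sum_distrib_left N_def)
  have swap: "(\<Sum>x\<in>?V. \<Sum>y\<in>?V. ?a x y * g x y) = (\<Sum>x\<in>?V. \<Sum>y\<in>?V. ?a x y * g y x)" for g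
    by (subst sum.swap) (simp add: adjacency_sym)
  have "of_real (\<Sum>x\<in>?V. \<Sum>y\<in>?V. adjacency G x y * (cmod (f x - f y))\<^sup>2)
      = (\<Sum>x\<in>?V. \<Sum>y\<in>?V. ?a x y * ((f x - f y) * cnj (f x - f y)))"
    by (simp only: of_real_sum of_real_mult complex_norm_square)
  also have "\<dots> = (\<Sum>x\<in>?V. \<Sum>y\<in>?V. ?a x y * (f x * cnj (f x)))
      + (\<Sum>x\<in>?V. \<Sum>y\<in>?V. ?a x y * (f y * cnj (f y)))
      - (\<Sum>x\<in>?V. \<Sum>y\<in>?V. ?a x y * (cnj (f x) * f y))
      - (\<Sum>x\<in>?V. \<Sum>y\<in>?V. ?a x y * (cnj (f y) * f x))"
    unfolding sum.distrib[symmetric] sum_subtractf[symmetric]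
    by (intro sum.cong refl) (simp add: algebra_simps)
  also have "\<dots> = 2 * of_nat d * N - 2 * X"
    using swap[of "\<lambda>x y. f y * cnj (f y)"] swap[of "\<lambda>x y. cnj (f y) * f x"] 1
    by (simp add: X_def)
  finally have Q: "of_real (\<Sum>x\<in>?V. \<Sum>y\<in>?V. adjacency G x y * (cmod (f x - f y))\<^sup>2)
      = 2 * of_nat d * N - 2 * X" .
  have "(\<Sum>x\<in>?V. cnj (f x) * (\<Sum>y\<in>?V. of_real (normalized_laplacian G x y) * f y))
      = (\<Sum>x\<in>?V. cnj (f x) * (f x - (\<Sum>y\<in>?V. ?a x y * f y) / of_nat d))"
  proof (intro sum.cong refl arg_cong2[where f="(*)"])
    fix x assume x: "x \<in> ?V"
    have "(\<Sum>y\<in>?V. of_real (normalized_laplacian G x y) * f y)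
        = (\<Sum>y\<in>?V. (if x = y then f y else 0) - ?a x y * f y / of_nat d)"
      by (intro sum.cong refl) (simp add: laplacian_eq[OF x] algebra_simps)
    then show "(\<Sum>y\<in>?V. of_real (normalized_laplacian G x y) * f y)
        = f x - (\<Sum>y\<in>?V. ?a x y * f y) / of_nat d"
      using x fin by (simp add: sum_subtractf sum_divide_distrib)
  qed
  also have "\<dots> = N - X / of_nat d"
    by (simp add: N_def X_def algebra_simps sum_subtractf sum_divide_distrib sum_distrib_left)
  also have "\<dots> = (2 * of_nat d * N - 2 * X) / (2 * of_nat d)"
    using degree_pos by (simp add: field_simps)
  finally show ?thesis
    by (simp add: Q[symmetric])
qed

end

section \<open>Spectral bounds and the zero eigenspace\<close>

locale regular_graph_eigensystem = connected_regular_graph G d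
  for G :: "'a pair_pre_digraph" and d +
  fixes ev :: "nat \<Rightarrow> real" and \<phi> :: "nat \<Rightarrow> 'a \<Rightarrow> complex"
  assumes system: "orthonormal_eigensystem G ev \<phi>"

sublocale regular_graph_eigensystem \<subseteq>
  basis: orthonormal_eigenbasis "pverts G" "normalized_laplacian G" "{..<card (pverts G)}" ev \<phi>
proof
  show "normalized_laplacian G x y = normalized_laplacian G y x" if "x \<in> pverts G" "y \<in> pverts G" for x y
    using that by (auto simp: laplacian_eq adjacency_sym)
qed (use system in \<open>auto simp: orthonormal_eigensystem_def pair_finite_verts\<close>)

context regular_graph_eigensystem
begin

lemma sum_cmod_sq: "j < card (pverts G) \<Longrightarrow> (\<Sum>x\<in>pverts G. (cmod (\<phi> j x))\<^sup>2) = 1"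
proof -
  assume "j < card (pverts G)"
  then have "complex_of_real (\<Sum>x\<in>pverts G. (cmod (\<phi> j x))\<^sup>2) = of_real 1"
    using basis.ortho[of j j] by (simp only: of_real_sum complex_norm_square) simp
  then show ?thesis by (simp only: of_real_eq_iff)
qed

text \<open>Pairing the eigenvalue equation with the unit vector \<open>\<phi> j\<close> gives its
  Rayleigh quotient, which the Dirichlet form evaluates.\<close>

lemma eigenvalue_eq:
  assumes j: "j < card (pverts G)"
  shows "ev j = (\<Sum>x\<in>pverts G. \<Sum>y\<in>pverts G. adjacency G x y * (cmod (\<phi> j x - \<phi> j y))\<^sup>2) / (2 * real d)"
proof -
  have "(\<Sum>x\<in>pverts G. cnj (\<phi> j x) * (\<Sum>y\<in>pverts G. of_real (normalized_laplacian G x y) * \<phi> j y))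
      = of_real (ev j) * (\<Sum>x\<in>pverts G. \<phi> j x * cnj (\<phi> j x))"
    unfolding sum_distrib_left[of "of_real (ev j)"] using j
    by (intro sum.cong refl) (simp add: basis.eigen)
  also have "\<dots> = of_real (ev j)"
    using j by (simp add: basis.ortho)
  finally show ?thesis
    unfolding dirichlet_form of_real_eq_iff by simp
qed

lemma eigenvalue_nonneg: "j < card (pverts G) \<Longrightarrow> ev j \<ge> 0"
  by (simp add: eigenvalue_eq adjacency_nonneg sum_nonneg)

text \<open>Since \<open>|a - b|^2\<close> is at most \<open>2 |a|^2 + 2 |b|^2\<close> and adjacency
  rows and columns sum to \<open>d\<close>, the Dirichlet sum is at most \<open>4 d\<close>, against
  the denominator \<open>2 d\<close>. This keeps the spectrum inside the contour.\<close>

lemma eigenvalue_le_2: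
  assumes j: "j < card (pverts G)"
  shows "ev j \<le> 2"
proof -
  let ?V = "pverts G" and ?s = "\<lambda>x. (cmod (\<phi> j x))\<^sup>2"
  have sq: "(cmod (a - b))\<^sup>2 \<le> 2 * (cmod a)\<^sup>2 + 2 * (cmod b)\<^sup>2" for a b
  proof -
    have "(cmod (a - b))\<^sup>2 \<le> (cmod a + cmod b)\<^sup>2"
      by (intro power_mono norm_triangle_ineq4) simp
    also have "\<dots> \<le> 2 * (cmod a)\<^sup>2 + 2 * (cmod b)\<^sup>2"
      using zero_le_power2[of "cmod a - cmod b"] by (simp add: power2_eq_square algebra_simps)
    finally show ?thesis .
  qed
  have row: "(\<Sum>x\<in>?V. \<Sum>y\<in>?V. adjacency G x y * ?s x) = real d"
    using sum_cmod_sq[OF j]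
    by (simp add: sum_distrib_right[symmetric] adjacency_row sum_distrib_left[symmetric])
  have col: "(\<Sum>x\<in>?V. \<Sum>y\<in>?V. adjacency G x y * ?s y) = real d"
    by (subst sum.swap, subst adjacency_sym, rule row)
  have "(\<Sum>x\<in>?V. \<Sum>y\<in>?V. adjacency G x y * (cmod (\<phi> j x - \<phi> j y))\<^sup>2)
      \<le> (\<Sum>x\<in>?V. \<Sum>y\<in>?V. adjacency G x y * (2 * ?s x + 2 * ?s y))"
    by (intro sum_mono mult_left_mono sq adjacency_nonneg)
  also have "\<dots> = 2 * (\<Sum>x\<in>?V. \<Sum>y\<in>?V. adjacency G x y * ?s x)
      + 2 * (\<Sum>x\<in>?V. \<Sum>y\<in>?V. adjacency G x y * ?s y)"
    unfolding sum_distrib_left sum.distrib[symmetric]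
    by (intro sum.cong refl) (simp add: algebra_simps)
  also have "\<dots> = 4 * real d"
    by (simp only: row col)
  finally show ?thesis
    using degree_pos by (simp add: eigenvalue_eq[OF j] field_simps)
qed

text \<open>A vanishing sum of nonnegative terms forces equality across every arc; connectedness
  does the rest.\<close>

lemma zero_eigenvector_constant:
  assumes j: "j < card (pverts G)" and zero: "ev j = 0"
    and x: "x \<in> pverts G" and y: "y \<in> pverts G"
  shows "\<phi> j x = \<phi> j y"
proof (rule constant_if_constant_on_arcs[OF _ x y])
  fix u v assume uv: "(u, v) \<in> parcs G"
  have "(\<Sum>x\<in>pverts G. \<Sum>y\<in>pverts G. adjacency G x y * (cmod (\<phi> j x - \<phi> j y))\<^sup>2) = 0"
    using zero degree_pos by (simp add: eigenvalue_eq[OF j])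
  then have "\<forall>x\<in>pverts G. \<forall>y\<in>pverts G. adjacency G x y * (cmod (\<phi> j x - \<phi> j y))\<^sup>2 = 0"
    by (simp add: pair_finite_verts sum_nonneg_eq_0_iff sum_nonneg adjacency_nonneg)
  with uv arc_in_verts[OF uv] show "\<phi> j u = \<phi> j v"
    by (fastforce simp: adjacency_def)
qed

text \<open>Two nonzero constant vectors cannot be orthogonal.\<close>

lemma zero_eigenvalue_simple:
  assumes j: "j < card (pverts G)" "ev j = 0" and k: "k < card (pverts G)" "ev k = 0"
  shows "j = k"
proof (rule ccontr)
  assume "j \<noteq> k"
  obtain z where z: "z \<in> pverts G"
    using verts_nonempty by auto
  have prod: "(\<Sum>x\<in>pverts G. \<phi> i x * cnj (\<phi> l x)) = of_nat (card (pverts G)) * (\<phi> i z * cnj (\<phi> l z))"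
    if "i < card (pverts G)" "ev i = 0" "l < card (pverts G)" "ev l = 0" for i l
  proof -
    have "(\<Sum>x\<in>pverts G. \<phi> i x * cnj (\<phi> l x)) = (\<Sum>x\<in>pverts G. \<phi> i z * cnj (\<phi> l z))"
      using that z by (intro sum.cong refl) (metis zero_eigenvector_constant)
    then show ?thesis by simp
  qed
  have "\<phi> j z \<noteq> 0" "\<phi> k z \<noteq> 0"
    using prod[of j j] prod[of k k] j k by (auto simp: basis.ortho)
  then show False
    using prod[of j k] j k \<open>j \<noteq> k\<close> z by (auto simp: basis.ortho pair_finite_verts)
qed

text \<open>These are the entries of the projection onto the constants. As the value is nonzero, the
  index set cannot be empty: 0 does occur as an eigenvalue.\<close>

lemma zero_eigenprojection:
  assumes x: "x \<in> pverts G" and y: "y \<in> pverts G"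
  shows "(\<Sum>j | j < card (pverts G) \<and> ev j = 0. \<phi> j x * cnj (\<phi> j y)) = 1 / of_nat (card (pverts G))"
proof -
  let ?V = "pverts G" and ?I = "{..<card (pverts G)}"
  let ?Z = "{j. j < card ?V \<and> ev j = 0}"
  \<comment> \<open>The constant function 1, in the shape of the hypothesis of
    \<open>eigenfunction_orthogonal\<close> for eigenvalue 0.\<close>
  have lap_const: "(\<Sum>y\<in>?V. of_real (normalized_laplacian G x y) * 1) = of_real 0 * (1 :: complex)"
    if "x \<in> ?V" for x
  proof -
    have "(\<Sum>y\<in>?V. normalized_laplacian G x y) = 0"
      using that degree_pos
      by (simp add: laplacian_eq sum_subtractf pair_finite_verts sum_divide_distrib[symmetric] adjacency_row)
    then show ?thesis
      by (simp flip: of_real_sum)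
  qed
  have mean: "(\<Sum>z\<in>?V. cnj (\<phi> j z)) = 0" if "j \<in> ?I" "ev j \<noteq> 0" for j
  proof -
    have "(\<Sum>z\<in>?V. \<phi> j z * cnj 1) = 0"
      using lap_const that by (intro basis.eigenfunction_orthogonal[where \<nu> = 0]) auto
    then have "cnj (\<Sum>z\<in>?V. \<phi> j z) = cnj 0" by simp
    then show ?thesis by simp
  qed
  \<comment> \<open>The factor turns the constant \<open>cnj (\<phi> j y)\<close> into a sum over
    all \<open>z\<close>. Then \<open>j\<close> may range over all indices, the new terms vanishing
    by \<open>mean\<close>, and completeness applies.\<close>
  have "of_nat (card ?V) * (\<Sum>j\<in>?Z. \<phi> j x * cnj (\<phi> j y)) = (\<Sum>j\<in>?Z. \<phi> j x * (\<Sum>z\<in>?V. cnj (\<phi> j z)))"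
    unfolding sum_distrib_left
  proof (intro sum.cong refl)
    fix j assume j: "j \<in> ?Z"
    have "(\<Sum>z\<in>?V. \<phi> j x * cnj (\<phi> j z)) = (\<Sum>z\<in>?V. \<phi> j x * cnj (\<phi> j y))"
    proof (intro sum.cong refl)
      fix z assume "z \<in> ?V"
      then have "\<phi> j z = \<phi> j y"
        using j y by (intro zero_eigenvector_constant) auto
      then show "\<phi> j x * cnj (\<phi> j z) = \<phi> j x * cnj (\<phi> j y)"
        by simp
    qed
    then show "of_nat (card ?V) * (\<phi> j x * cnj (\<phi> j y)) = (\<Sum>z\<in>?V. \<phi> j x * cnj (\<phi> j z))"
      by simp
  qed
  also have "\<dots> = (\<Sum>j\<in>?I. \<phi> j x * (\<Sum>z\<in>?V. cnj (\<phi> j z)))"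
    using mean by (intro sum.mono_neutral_left) auto
  also have "\<dots> = (\<Sum>z\<in>?V. \<Sum>j\<in>?I. \<phi> j x * cnj (\<phi> j z))"
    unfolding sum_distrib_left by (rule sum.swap)
  also have "\<dots> = (\<Sum>z\<in>?V. if x = z then 1 else 0)"
    by (intro sum.cong refl basis.complete x)
  also have "\<dots> = 1"
    using x by (simp add: pair_finite_verts)
  finally have "of_nat (card ?V) * (\<Sum>j\<in>?Z. \<phi> j x * cnj (\<phi> j y)) = 1" .
  moreover have "of_nat (card ?V) \<noteq> (0 :: complex)"
    using card_verts_ge_2 by auto
  ultimately show ?thesis
    by (metis nonzero_mult_div_cancel_left)
qed

lemma normalized_green_eq:
  "normalized_green G ev \<phi> x y =
     (\<Sum>j<card (pverts G). (if ev j > 0 then 1 / of_real (ev j) else 0) * \<phi> j x * cnj (\<phi> j y))"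
  unfolding normalized_green_def generalized_green_def
  by (intro sum.mono_neutral_cong_left) auto

end

section \<open>The Green's function of a Cartesian product\<close>

text \<open>The degrees of the factors add up to \<open>2 d\<close>, which is where the halving
  comes from.\<close>

lemma laplacian_cartesian_product:
  assumes "connected_regular_graph G d" and "connected_regular_graph H d"
    and x: "x \<in> pverts G" and y: "y \<in> pverts G" and x': "x' \<in> pverts H" and y': "y' \<in> pverts H"
  shows "normalized_laplacian (cartesian_product G H) (x, x') (y, y') =
    (normalized_laplacian G x y * (if x' = y' then 1 else 0)
      + (if x = y then 1 else 0) * normalized_laplacian H x' y') / 2"
proof -
  interpret G: connected_regular_graph G d by fact
  interpret H: connected_regular_graph H d by fact
  let ?P = "cartesian_product G H"
  \<comment> \<open>Absence of loops makes the two kinds of product arcs mutually exclusive, so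
    their indicators add.\<close>
  have adj: "adjacency ?P (x, x') (z, z')
      = (if x = z then adjacency H x' z' else 0) + (if x' = z' then adjacency G x z else 0)" for z z'
    using x x' G.no_loop H.no_loop by (auto simp: adjacency_def cartesian_product_def)
  have "real (out_degree (with_proj ?P) (x, x')) = (\<Sum>p\<in>pverts ?P. adjacency ?P (x, x') p)"
    by (rule sum_adjacency[symmetric])
      (auto simp: cartesian_product_def G.pair_finite_verts H.pair_finite_verts
        dest: G.arc_in_verts H.arc_in_verts)
  also have "\<dots> = (\<Sum>z\<in>pverts G. \<Sum>z'\<in>pverts H. adjacency ?P (x, x') (z, z'))"
    by (simp add: cartesian_product_def sum.cartesian_product case_prod_beta)
  also have "\<dots> = (\<Sum>z\<in>pverts G. (if x = z then (\<Sum>z'\<in>pverts H. adjacency H x' z') else 0) + adjacency G x z)"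
    using x' by (intro sum.cong refl) (simp add: adj sum.distrib H.pair_finite_verts)
  also have "\<dots> = 2 * real d"
    using x x' by (simp add: sum.distrib G.pair_finite_verts G.adjacency_row H.adjacency_row)
  finally have deg: "real (out_degree (with_proj ?P) (x, x')) = 2 * real d" .
  have no_loop: "((x, x'), (x, x')) \<notin> parcs ?P"
    using G.no_loop H.no_loop by (auto simp: cartesian_product_def)
  have "normalized_laplacian ?P (x, x') (y, y')
      = (if (x, x') = (y, y') then 1 else 0) - adjacency ?P (x, x') (y, y') / (2 * real d)"
    using no_loop by (auto simp: normalized_laplacian_def deg adjacency_def)
  also have "\<dots> = (normalized_laplacian G x y * (if x' = y' then 1 else 0)
      + (if x = y then 1 else 0) * normalized_laplacian H x' y') / 2"
    using x x' G.no_loop H.no_loop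
    unfolding adj by (auto simp: G.laplacian_eq H.laplacian_eq adjacency_def)
  finally show ?thesis .
qed

text \<open>The tensor eigenbasis may replace the given one, and the double sum is then sorted by
  which of the two eigenvalues is zero. The factors 2 invert the halved eigenvalues.\<close>

lemma green_cartesian_product:
  assumes "regular_graph_eigensystem G d ev \<phi>" and "regular_graph_eigensystem H d ev' \<phi>'"
    and system: "orthonormal_eigensystem (cartesian_product G H) evP \<phi>P"
    and x: "x \<in> pverts G" and y: "y \<in> pverts G" and x': "x' \<in> pverts H" and y': "y' \<in> pverts H"
  shows "normalized_green (cartesian_product G H) evP \<phi>P (x, x') (y, y') =
      2 * (\<Sum>k | k < card (pverts H) \<and> ev' k > 0.
            generalized_green G ev \<phi> (of_real (ev' k)) x y * (\<phi>' k x' * cnj (\<phi>' k y')))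
      + 2 / of_nat (card (pverts H)) * normalized_green G ev \<phi> x y
      + 2 / of_nat (card (pverts G)) * normalized_green H ev' \<phi>' x' y'"
proof -
  interpret G: regular_graph_eigensystem G d ev \<phi> by fact
  interpret H: regular_graph_eigensystem H d ev' \<phi>' by fact
  let ?P = "cartesian_product G H"
  let ?I = "{..<card (pverts G)}" and ?J = "{..<card (pverts H)}"
  \<comment> \<open>The value 0 for nonpositive \<open>t\<close> turns the Green's function into a
    sum over all indices, as \<open>spectral_sum_unique\<close> requires.\<close>
  define h where "h t = (if t > 0 then 1 / of_real t else 0 :: complex)" for t :: real
  define p where "p j = \<phi> j x * cnj (\<phi> j y)" for j
  define q where "q k = \<phi>' k x' * cnj (\<phi>' k y')" for k
  have vP: "pverts ?P = pverts G \<times> pverts H"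
    by (simp add: cartesian_product_def)
  have prod: "orthonormal_eigenbasis (pverts ?P) (normalized_laplacian ?P) (?I \<times> ?J)
      (\<lambda>(j, k). (ev j + ev' k) / 2) (\<lambda>(j, k) (x, y). \<phi> j x * \<phi>' k y)"
    unfolding vP
    by (rule orthonormal_eigenbasis_product[OF G.basis.orthonormal_eigenbasis_axioms
          H.basis.orthonormal_eigenbasis_axioms laplacian_cartesian_product[OF
            G.connected_regular_graph_axioms H.connected_regular_graph_axioms]])
  \<comment> \<open>Symmetry and finiteness are inherited from \<open>prod\<close>.\<close>
  have given: "orthonormal_eigenbasis (pverts ?P) (normalized_laplacian ?P) {..<card (pverts ?P)} evP \<phi>P"
    using system orthonormal_eigenbasis.sym[OF prod] orthonormal_eigenbasis.finite_V[OF prod]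
    by unfold_locales (auto simp: orthonormal_eigensystem_def)
  \<comment> \<open>If both eigenvalues are 0, every term is 0 because \<open>h 0 = 0\<close>, so
    that pair drops out by itself.\<close>
  have split: "h ((ev j + ev' k) / 2) =
      (if ev j > 0 \<and> ev' k > 0 then 2 / (of_real (ev j) + of_real (ev' k)) else 0)
      + 2 * (if ev' k = 0 then h (ev j) else 0) + 2 * (if ev j = 0 then h (ev' k) else 0)"
    if "j \<in> ?I" "k \<in> ?J" for j k
    using G.eigenvalue_nonneg[of j] H.eigenvalue_nonneg[of k] that
    by (auto simp: h_def)
  have q0: "(\<Sum>k\<in>?J. if ev' k = 0 then q k else 0) = 1 / of_nat (card (pverts H))"
    unfolding H.zero_eigenprojection[OF x' y', symmetric] q_def
    by (intro sum.mono_neutral_cong_right) auto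
  have p0: "(\<Sum>j\<in>?I. if ev j = 0 then p j else 0) = 1 / of_nat (card (pverts G))"
    unfolding G.zero_eigenprojection[OF x y, symmetric] p_def
    by (intro sum.mono_neutral_cong_right) auto
  have "normalized_green ?P evP \<phi>P (x, x') (y, y')
      = (\<Sum>l<card (pverts ?P). h (evP l) * \<phi>P l (x, x') * cnj (\<phi>P l (y, y')))"
    unfolding normalized_green_def generalized_green_def h_def
    by (intro sum.mono_neutral_cong_left) auto
  also have "\<dots> = (\<Sum>l\<in>?I \<times> ?J. h ((\<lambda>(j, k). (ev j + ev' k) / 2) l)
      * (\<lambda>(j, k) (x, y). \<phi> j x * \<phi>' k y) l (x, x') * cnj ((\<lambda>(j, k) (x, y). \<phi> j x * \<phi>' k y) l (y, y')))"
    by (rule spectral_sum_unique[OF given prod]) (use x y x' y' in \<open>auto simp: vP\<close>)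
  also have "\<dots> = (\<Sum>j\<in>?I. \<Sum>k\<in>?J. h ((ev j + ev' k) / 2) * (p j * q k))"
    by (simp add: sum.cartesian_product case_prod_beta p_def q_def mult_ac)
  also have "\<dots> = (\<Sum>j\<in>?I. \<Sum>k\<in>?J.
      (if ev j > 0 \<and> ev' k > 0 then 2 / (of_real (ev j) + of_real (ev' k)) * (p j * q k) else 0)
      + 2 * ((h (ev j) * p j) * (if ev' k = 0 then q k else 0))
      + 2 * ((if ev j = 0 then p j else 0) * (h (ev' k) * q k)))"
    by (intro sum.cong refl) (simp add: split algebra_simps)
  also have "\<dots> = (\<Sum>j\<in>?I. \<Sum>k\<in>?J.
        if ev j > 0 \<and> ev' k > 0 then 2 / (of_real (ev j) + of_real (ev' k)) * (p j * q k) else 0)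
      + 2 * ((\<Sum>j\<in>?I. h (ev j) * p j) * (\<Sum>k\<in>?J. if ev' k = 0 then q k else 0))
      + 2 * ((\<Sum>j\<in>?I. if ev j = 0 then p j else 0) * (\<Sum>k\<in>?J. h (ev' k) * q k))"
    unfolding sum.distrib sum_product unfolding sum_distrib_left by (rule refl)
  \<comment> \<open>The sum over \<open>k\<close> goes outside because the contour integral yields
    one contribution per positive \<open>ev' k\<close>.\<close>
  also have "(\<Sum>j\<in>?I. \<Sum>k\<in>?J.
        if ev j > 0 \<and> ev' k > 0 then 2 / (of_real (ev j) + of_real (ev' k)) * (p j * q k) else 0)
      = (\<Sum>k\<in>?J. \<Sum>j\<in>?I.
        if ev j > 0 \<and> ev' k > 0 then 2 / (of_real (ev j) + of_real (ev' k)) * (p j * q k) else 0)"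
    by (rule sum.swap)
  also have "\<dots> = (\<Sum>k | k < card (pverts H) \<and> ev' k > 0. \<Sum>j | j < card (pverts G) \<and> ev j > 0.
        2 / (of_real (ev j) + of_real (ev' k)) * (p j * q k))"
    by (intro sum.mono_neutral_cong_right ballI sum.neutral) auto
  also have "\<dots> = 2 * (\<Sum>k | k < card (pverts H) \<and> ev' k > 0.
            generalized_green G ev \<phi> (of_real (ev' k)) x y * q k)"
    by (simp add: generalized_green_def p_def sum_distrib_left sum_distrib_right mult_ac)
  also have "(\<Sum>j\<in>?I. h (ev j) * p j) = normalized_green G ev \<phi> x y"
    by (simp add: G.normalized_green_eq h_def p_def mult_ac)
  also have "(\<Sum>k\<in>?J. h (ev' k) * q k) = normalized_green H ev' \<phi>' x' y'"
    by (simp add: H.normalized_green_eq h_def q_def mult_ac)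
  finally show ?thesis
    by (simp add: q0 p0 q_def mult_ac)
qed

section \<open>Evaluation of the contour integral\<close>

text \<open>The second factor is a sum of terms with denominators \<open>ev' k - \<alpha>\<close>,
  whose zeros are all enclosed; the first is holomorphic on the closed disc, its denominators
  vanishing only at negative reals. Cauchy's formula applies to each term.\<close>

lemma contour_integral_green:
  fixes c :: complex and r :: real
  assumes inside: "\<And>k. k < card (pverts H) \<Longrightarrow> ev' k > 0 \<Longrightarrow> cmod (of_real (ev' k) - c) < r"
    and right: "\<And>\<alpha>. \<alpha> \<in> cball c r \<Longrightarrow> Re \<alpha> > 0"
  shows "contour_integral (reversepath (circlepath c r))
      (\<lambda>\<alpha>. generalized_green G ev \<phi> \<alpha> x y * generalized_green H ev' \<phi>' (- \<alpha>) x' y')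
    = 2 * of_real pi * \<i> * (\<Sum>k | k < card (pverts H) \<and> ev' k > 0.
        generalized_green G ev \<phi> (of_real (ev' k)) x y * (\<phi>' k x' * cnj (\<phi>' k y')))"
proof -
  let ?K = "{k. k < card (pverts H) \<and> ev' k > 0}"
  let ?g = "\<lambda>\<alpha>. generalized_green G ev \<phi> \<alpha> x y" and ?q = "\<lambda>k. \<phi>' k x' * cnj (\<phi>' k y')"
  have nz: "of_real t + \<alpha> \<noteq> 0" if "t > 0" "\<alpha> \<in> cball c r" for t \<alpha>
    using right[OF that(2)] that(1) by (auto simp: complex_eq_iff)
  have holo: "?g holomorphic_on cball c r"
    unfolding generalized_green_def by (intro holomorphic_intros) (use nz in auto)
  have "((\<lambda>\<alpha>. \<Sum>k\<in>?K. - ?q k * (?g \<alpha> / (\<alpha> - of_real (ev' k)))) has_contour_integral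
      (\<Sum>k\<in>?K. - ?q k * (2 * of_real pi * \<i> * ?g (of_real (ev' k))))) (circlepath c r)"
    by (intro has_contour_integral_sum has_contour_integral_lmul
        Cauchy_integral_circlepath_simple holo) (auto intro: inside)
  \<comment> \<open>The clockwise orientation supplies a minus sign, cancelling the one from writing
    the denominators as \<open>\<alpha> - ev' k\<close>.\<close>
  then have "((\<lambda>\<alpha>. \<Sum>k\<in>?K. - ?q k * (?g \<alpha> / (\<alpha> - of_real (ev' k)))) has_contour_integral
      - (\<Sum>k\<in>?K. - ?q k * (2 * of_real pi * \<i> * ?g (of_real (ev' k))))) (reversepath (circlepath c r))"
    by (intro has_contour_integral_reversepath) auto
  moreover have "(\<lambda>\<alpha>. \<Sum>k\<in>?K. - ?q k * (?g \<alpha> / (\<alpha> - of_real (ev' k))))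
      = (\<lambda>\<alpha>. ?g \<alpha> * generalized_green H ev' \<phi>' (- \<alpha>) x' y')"
  proof
    fix \<alpha>
    \<comment> \<open>Valid even at \<open>\<alpha> = t\<close>, where both sides are 0 because
      division by zero gives 0.\<close>
    have "- q * (g / (\<alpha> - t)) = g * (1 / (t + - \<alpha>) * q)" for q g t :: complex
    proof -
      have "\<alpha> - t = - (t + - \<alpha>)" by simp
      then show ?thesis by (simp only: divide_minus_right) simp
    qed
    then show "(\<Sum>k\<in>?K. - ?q k * (?g \<alpha> / (\<alpha> - of_real (ev' k))))
        = ?g \<alpha> * generalized_green H ev' \<phi>' (- \<alpha>) x' y'"
      unfolding generalized_green_def[of H] sum_distrib_left
      by (intro sum.cong refl) (simp only: mult.assoc)
  qed
  moreover have "- (\<Sum>k\<in>?K. - ?q k * (2 * of_real pi * \<i> * ?g (of_real (ev' k))))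
      = 2 * of_real pi * \<i> * (\<Sum>k\<in>?K. ?g (of_real (ev' k)) * ?q k)"
    by (simp add: sum_negf sum_distrib_left mult_ac)
  ultimately show ?thesis
    by (simp add: contour_integral_unique)
qed

section \<open>Position of the spectrum relative to the circle, and conclusion\<close>

theorem theorem8:
  fixes \<Gamma> :: "'a pair_pre_digraph" and \<Gamma>' :: "'b pair_pre_digraph"
    and d m n :: nat
    and ev ev' evP :: "nat \<Rightarrow> real"
    and \<phi> :: "nat \<Rightarrow> 'a \<Rightarrow> complex"
    and \<phi>' :: "nat \<Rightarrow> 'b \<Rightarrow> complex"
    and \<phi>P :: "nat \<Rightarrow> 'a \<times> 'b \<Rightarrow> complex"
    and x y :: 'a and x' y' :: 'b
  assumes "pair_graph \<Gamma>" and "Digraph_Component.connected (with_proj \<Gamma>)" and "regular_graph \<Gamma> d"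
    and "pair_graph \<Gamma>'" and "Digraph_Component.connected (with_proj \<Gamma>')" and "regular_graph \<Gamma>' d"
    and "d \<ge> 1"
    and "m = card (pverts \<Gamma>)" and "n = card (pverts \<Gamma>')"
    and "orthonormal_eigensystem \<Gamma> ev \<phi>"
    and "orthonormal_eigensystem \<Gamma>' ev' \<phi>'" and "mono_on {..<n} ev'"
    and "orthonormal_eigensystem (cartesian_product \<Gamma> \<Gamma>') evP \<phi>P"
    and "x \<in> pverts \<Gamma>" and "y \<in> pverts \<Gamma>" and "x' \<in> pverts \<Gamma>'" and "y' \<in> pverts \<Gamma>'"
  shows "normalized_green (cartesian_product \<Gamma> \<Gamma>') evP \<phi>P (x, x') (y, y') =
      1 / (of_real pi * \<i>) *
        contour_integral (reversepath (circlepath (of_real (2 + ev' 1 / 2)) 2))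
          (\<lambda>\<alpha>. generalized_green \<Gamma> ev \<phi> \<alpha> x y * generalized_green \<Gamma>' ev' \<phi>' (- \<alpha>) x' y')
      + 2 / of_nat n * normalized_green \<Gamma> ev \<phi> x y
      + 2 / of_nat m * normalized_green \<Gamma>' ev' \<phi>' x' y'"
proof -
  interpret G: regular_graph_eigensystem \<Gamma> d ev \<phi>
    using assms by (simp add: regular_graph_eigensystem_def regular_graph_eigensystem_axioms_def
        connected_regular_graph_def connected_regular_graph_axioms_def)
  interpret H: regular_graph_eigensystem \<Gamma>' d ev' \<phi>'
    using assms by (simp add: regular_graph_eigensystem_def regular_graph_eigensystem_axioms_def
        connected_regular_graph_def connected_regular_graph_axioms_def)
  have n2: "n \<ge> 2"
    using H.card_verts_ge_2 assms(9) by simp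
  \<comment> \<open>Otherwise monotonicity and nonnegativity put the eigenvalue 0 at both indices 0
    and 1, against simplicity.\<close>
  have pos: "ev' 1 > 0"
  proof (rule ccontr)
    assume "\<not> ev' 1 > 0"
    moreover have "ev' 0 \<le> ev' 1"
      using assms(12) n2 by (auto simp: mono_on_def)
    ultimately have "ev' 0 = 0" "ev' 1 = 0"
      using H.eigenvalue_nonneg[of 0] H.eigenvalue_nonneg[of 1] n2 assms(9) by auto
    then show False
      using H.zero_eigenvalue_simple[of 0 1] n2 assms(9) by simp
  qed
  let ?c = "of_real (2 + ev' 1 / 2) :: complex"
  \<comment> \<open>The circle meets the real axis at \<open>ev' 1 / 2\<close> and
    \<open>4 + ev' 1 / 2\<close>, strictly enclosing the interval from \<open>ev' 1\<close> to
    2.\<close>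
  have inside: "cmod (of_real (ev' k) - ?c) < 2" if k: "k < card (pverts \<Gamma>')" "ev' k > 0" for k
  proof -
    \<comment> \<open>If \<open>ev' 0\<close> were positive, so would be all eigenvalues by
      monotonicity, and the zero eigenprojection would be an empty sum with value
      \<open>1 / n\<close>.\<close>
    have "k \<noteq> 0"
    proof
      assume "k = 0"
      with k have z: "\<And>j. j < n \<Longrightarrow> ev' j > 0"
        using assms(12) n2 by (auto simp: mono_on_def intro: less_le_trans)
      have "{j. j < card (pverts \<Gamma>') \<and> ev' j = 0} = {}"
        using z assms(9) by force
      then show False
        using H.zero_eigenprojection[of x' x'] assms(16) n2 assms(9)
        by (simp only: sum.empty) simp
    qed
    then have "ev' 1 \<le> ev' k"
      using assms(9,12) k n2 by (auto simp: mono_on_def)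
    moreover have "cmod (of_real (ev' k) - ?c) = \<bar>ev' k - (2 + ev' 1 / 2)\<bar>"
      by (metis norm_of_real of_real_diff)
    ultimately show ?thesis
      using H.eigenvalue_le_2[OF k(1)] pos by linarith
  qed
  \<comment> \<open>The leftmost point of the disc is \<open>ev' 1 / 2\<close>.\<close>
  have right: "Re \<alpha> > 0" if "\<alpha> \<in> cball ?c 2" for \<alpha>
  proof -
    have "\<bar>Re (?c - \<alpha>)\<bar> \<le> 2"
      using that abs_Re_le_cmod[of "?c - \<alpha>"] by (simp only: mem_cball dist_norm)
    then show ?thesis
      using pos by simp
  qed
  have integral: "contour_integral (reversepath (circlepath ?c 2))
      (\<lambda>\<alpha>. generalized_green \<Gamma> ev \<phi> \<alpha> x y * generalized_green \<Gamma>' ev' \<phi>' (- \<alpha>) x' y')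
    = 2 * of_real pi * \<i> * (\<Sum>k | k < card (pverts \<Gamma>') \<and> ev' k > 0.
        generalized_green \<Gamma> ev \<phi> (of_real (ev' k)) x y * (\<phi>' k x' * cnj (\<phi>' k y')))"
    using inside right by (rule contour_integral_green)
  \<comment> \<open>With \<open>pi\<close> in place of \<open>2 pi\<close> in the prefactor, the
    factor 2 coming from the halved eigenvalues remains.\<close>
  have cancel: "1 / (of_real pi * \<i>) * (2 * of_real pi * \<i> * S) = 2 * S" for S :: complex
    by (simp add: field_simps)
  note green = green_cartesian_product[OF G.regular_graph_eigensystem_axioms
      H.regular_graph_eigensystem_axioms assms(13-17)]
  show ?thesis
    unfolding assms(8,9) integral cancel by (rule green)
qed

end
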